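(* Let $\mathcal{D}$ be a non-empty set of bounded conditional random variables, $\underline{P}:\mathcal{D}\to\mathbb{R}$ a map, $n\ge 0$ an integer, $X_0|B_0,\dots,X_n|B_n\in\mathcal{D}$ and $s_0,\dots,s_n\ge 0$ real numbers. Define $B=\bigvee_{i=0}^nB_i$, $$I=-s_0B_0X_0+\sum_{i=1}^n s_iB_iX_i,\qquad E=-s_0B_0\underline{P}(X_0|B_0)+\sum_{i=1}^n s_iB_i\underline{P}(X_i|B_i).$$ (a) If, for every $\lambda_0\in\mathbb{R}$, $\lambda_0\le\inf(-I|B)$ implies $\lambda_0\le\inf(-E|B)$, then $\sup(I-E|B)\ge 0$. (b) If $\sup(I-E|B)\ge 0$, then for every $\lambda_0\in\mathbb{R}$, $\lambda_0\le\inf(-I|B)$ implies $\lambda_0\le\sup(-E|B)$.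
   Context: Conventions. A bounded random variable is a bounded map $X:\mathcal{B}\to\mathbb{R}$ on a partition $\mathcal{B}$ of non-impossible events $\omega$ (the atoms); all random variables and events considered together are described on a common, sufficiently fine partition. An event $B$ is identified with the set of atoms implying it, and the same symbol $B$ denotes its indicator function. For a non-impossible (non-empty) event $B$, the conditional random variable $X|B$ is the restriction of $X$ to the atoms implying $B$; $\sup(X|B)$ and $\inf(X|B)$ are the supremum and infimum of $X(\omega)$ over atoms $\omega\Rightarrow B$. The notation $I-E|B$ means $(I-E)|B$. *)

theory Defs
  imports "HOL-Analysis.Analysis"
begin

(* The elements of the type 'w are the atoms of the common partition, so that an
   event is a set of type 'w set and is non-impossible iff it is non-empty. *)

definition bounded_rv :: "('w \<Rightarrow> real) \<Rightarrow> bool" where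
  "bounded_rv X \<longleftrightarrow> bounded (range X)"

(* X|B is the restriction of X to B: a partial map with domain B, which does not
   depend on the values of X outside B. *)
definition cond_rv :: "('w \<Rightarrow> real) \<Rightarrow> 'w set \<Rightarrow> ('w \<rightharpoonup> real)" where
  "cond_rv X B = (Some \<circ> X) |` B"

definition bounded_cond_rvs :: "('w \<rightharpoonup> real) set" where
  "bounded_cond_rvs = {cond_rv X B |X B. bounded_rv X \<and> B \<noteq> {}}"

(* Supremum and infimum in the reals: meaningful because they are only applied to
   bounded random variables conditional on non-empty events. *)
definition rv_sup :: "('w \<rightharpoonup> real) \<Rightarrow> real" where
  "rv_sup Y = Sup (ran Y)"

definition rv_inf :: "('w \<rightharpoonup> real) \<Rightarrow> real" where
  "rv_inf Y = Inf (ran Y)"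

end

theory Submission
  imports Defs
begin

text \<open>
  Put \<open>U = - I\<close> and \<open>V = - E\<close>, so that \<open>I - E = V - U\<close>. Both parts compare the extrema of a
  difference with the difference of the extrema: conditionally on a non-empty event, bounded
  random variables satisfy

    \<open>inf V - inf U \<le> sup (V - U) \<le> sup V - inf U\<close>,

  because \<open>V - sup (V - U) \<le> U\<close> and \<open>V - U \<le> V - inf U\<close> hold at every atom. The premise of
  part (a), taken at \<open>\<lambda>\<^sub>0 = inf U\<close>, says \<open>inf U \<le> inf V\<close>, and the left inequality
  (\<open>rv_inf_diff_le_rv_sup\<close>) then gives (a). If \<open>sup (V - U) \<ge> 0\<close>, the right inequality
  (\<open>rv_sup_diff_le\<close>) gives \<open>inf U \<le> sup V\<close>, which is (b). What remains is that \<open>I\<close> and \<open>E\<close> are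
  bounded (\<open>bounded_rv_gain\<close>), so that the real \<open>Sup\<close> and \<open>Inf\<close> really bound the values.
\<close>

lemma ran_cond_rv: "ran (cond_rv X B) = X ` B"
  by (auto simp: cond_rv_def ran_def restrict_map_def)

lemma bounded_rv_iff: "bounded_rv X \<longleftrightarrow> (\<exists>c. \<forall>\<omega>. \<bar>X \<omega>\<bar> \<le> c)"
  by (auto simp: bounded_rv_def bounded_iff)

lemma bounded_rv_uminus: "bounded_rv X \<Longrightarrow> bounded_rv (\<lambda>\<omega>. - X \<omega>)"
  by (simp add: bounded_rv_iff)

lemma bounded_rv_add:
  assumes "bounded_rv X" "bounded_rv Y"
  shows "bounded_rv (\<lambda>\<omega>. X \<omega> + Y \<omega>)"
proof -
  obtain c d where "\<And>\<omega>. \<bar>X \<omega>\<bar> \<le> c" "\<And>\<omega>. \<bar>Y \<omega>\<bar> \<le> d"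
    using assms unfolding bounded_rv_iff by blast
  then have "\<bar>X \<omega> + Y \<omega>\<bar> \<le> c + d" for \<omega>
    by (meson abs_triangle_ineq add_mono order_trans)
  then show ?thesis
    unfolding bounded_rv_iff by blast
qed

lemma bounded_rv_mult:
  assumes "bounded_rv X" "bounded_rv Y"
  shows "bounded_rv (\<lambda>\<omega>. X \<omega> * Y \<omega>)"
proof -
  obtain c d where "\<And>\<omega>. \<bar>X \<omega>\<bar> \<le> c" "\<And>\<omega>. \<bar>Y \<omega>\<bar> \<le> d"
    using assms unfolding bounded_rv_iff by blast
  then have "\<bar>X \<omega> * Y \<omega>\<bar> \<le> c * d" for \<omega>
    unfolding abs_mult by (meson abs_ge_zero mult_mono order_trans)
  then show ?thesis
    unfolding bounded_rv_iff by blast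
qed

lemma bounded_rv_const: "bounded_rv (\<lambda>\<omega>. c)"
  by (auto simp: bounded_rv_iff)

lemma bounded_rv_indicator: "bounded_rv (indicat_real B)"
  unfolding bounded_rv_iff by (rule exI[of _ 1]) (simp add: indicator_def)

lemma bounded_rv_sum:
  assumes "\<And>i. i \<in> A \<Longrightarrow> bounded_rv (X i)"
  shows "bounded_rv (\<lambda>\<omega>. \<Sum>i\<in>A. X i \<omega>)"
  using assms
  by (induction A rule: infinite_finite_induct) (auto intro: bounded_rv_add bounded_rv_const)

text \<open>
  The random variables \<open>X i\<close> are arbitrary bounded ones here, so that the lemma covers both the
  gain \<open>I\<close> and, with constant \<open>X i\<close>, its price \<open>E\<close>.
\<close>

lemma bounded_rv_gain:
  fixes n :: nat
  assumes "\<And>i. i \<le> n \<Longrightarrow> bounded_rv (X i)"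
  shows "bounded_rv (\<lambda>\<omega>. - s 0 * indicat_real (B 0) \<omega> * X 0 \<omega>
                          + (\<Sum>i = 1..n. s i * indicat_real (B i) \<omega> * X i \<omega>))"
  by (intro bounded_rv_add bounded_rv_sum bounded_rv_mult bounded_rv_const bounded_rv_indicator
      assms) auto

lemma rv_le_rv_sup:
  assumes "bounded_rv X" "\<omega> \<in> B"
  shows "X \<omega> \<le> rv_sup (cond_rv X B)"
proof -
  have "bdd_above (X ` B)"
    using assms(1) unfolding bounded_rv_def
    by (meson bounded_imp_bdd_above bounded_subset image_mono subset_UNIV)
  then show ?thesis
    using assms(2) by (simp add: rv_sup_def ran_cond_rv cSUP_upper)
qed

lemma rv_inf_le_rv:
  assumes "bounded_rv X" "\<omega> \<in> B"
  shows "rv_inf (cond_rv X B) \<le> X \<omega>"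
proof -
  have "bdd_below (X ` B)"
    using assms(1) unfolding bounded_rv_def
    by (meson bounded_imp_bdd_below bounded_subset image_mono subset_UNIV)
  then show ?thesis
    using assms(2) by (simp add: rv_inf_def ran_cond_rv cINF_lower)
qed

lemma rv_sup_le:
  assumes "B \<noteq> {}" "\<And>\<omega>. \<omega> \<in> B \<Longrightarrow> X \<omega> \<le> c"
  shows "rv_sup (cond_rv X B) \<le> c"
  using assms by (simp add: rv_sup_def ran_cond_rv cSUP_least)

lemma le_rv_inf:
  assumes "B \<noteq> {}" "\<And>\<omega>. \<omega> \<in> B \<Longrightarrow> c \<le> X \<omega>"
  shows "c \<le> rv_inf (cond_rv X B)"
  using assms by (simp add: rv_inf_def ran_cond_rv cINF_greatest)

text \<open>
  Lowering \<open>V\<close> by the supremum \<open>m\<close> of \<open>V - U\<close> puts it below \<open>U\<close>, so \<open>inf V - m\<close> is a lower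
  bound of \<open>U\<close>.
\<close>

lemma rv_inf_diff_le_rv_sup:
  assumes "bounded_rv U" "bounded_rv V" "B \<noteq> {}"
  shows "rv_inf (cond_rv V B) - rv_inf (cond_rv U B) \<le> rv_sup (cond_rv (\<lambda>\<omega>. V \<omega> - U \<omega>) B)"
proof -
  let ?m = "rv_sup (cond_rv (\<lambda>\<omega>. V \<omega> - U \<omega>) B)"
  have diff: "bounded_rv (\<lambda>\<omega>. V \<omega> - U \<omega>)"
    using bounded_rv_add[OF assms(2) bounded_rv_uminus[OF assms(1)]] by simp
  have "rv_inf (cond_rv V B) - ?m \<le> rv_inf (cond_rv U B)"
  proof (rule le_rv_inf[OF assms(3)])
    fix \<omega> assume "\<omega> \<in> B"
    with rv_inf_le_rv[OF assms(2)] rv_le_rv_sup[OF diff]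
    have "rv_inf (cond_rv V B) \<le> V \<omega>" "V \<omega> - U \<omega> \<le> ?m"
      by blast+
    then show "rv_inf (cond_rv V B) - ?m \<le> U \<omega>"
      by linarith
  qed
  then show ?thesis
    by linarith
qed

lemma rv_sup_diff_le:
  assumes "bounded_rv U" "bounded_rv V" "B \<noteq> {}"
  shows "rv_sup (cond_rv (\<lambda>\<omega>. V \<omega> - U \<omega>) B) \<le> rv_sup (cond_rv V B) - rv_inf (cond_rv U B)"
  using assms by (intro rv_sup_le diff_mono rv_le_rv_sup rv_inf_le_rv)

theorem proposition2:
  fixes D :: "('w \<rightharpoonup> real) set"
    and P :: "('w \<rightharpoonup> real) \<Rightarrow> real"
    and n :: nat
    and X :: "nat \<Rightarrow> 'w \<Rightarrow> real"
    and B :: "nat \<Rightarrow> 'w set"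
    and s :: "nat \<Rightarrow> real"
    and BB :: "'w set"
    and I E :: "'w \<Rightarrow> real"
  assumes "D \<noteq> {}"
    and "D \<subseteq> bounded_cond_rvs"
    and "\<And>i. i \<le> n \<Longrightarrow> bounded_rv (X i)"
    and "\<And>i. i \<le> n \<Longrightarrow> B i \<noteq> {}"
    and "\<And>i. i \<le> n \<Longrightarrow> cond_rv (X i) (B i) \<in> D"
    and "\<And>i. i \<le> n \<Longrightarrow> s i \<ge> 0"
    and "BB = (\<Union>i\<le>n. B i)"
    and "I = (\<lambda>\<omega>. - s 0 * indicat_real (B 0) \<omega> * X 0 \<omega>
                 + (\<Sum>i = 1..n. s i * indicat_real (B i) \<omega> * X i \<omega>))"
    and "E = (\<lambda>\<omega>. - s 0 * indicat_real (B 0) \<omega> * P (cond_rv (X 0) (B 0))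
                 + (\<Sum>i = 1..n. s i * indicat_real (B i) \<omega> * P (cond_rv (X i) (B i))))"
  shows "((\<forall>l0 :: real. l0 \<le> rv_inf (cond_rv (\<lambda>\<omega>. - I \<omega>) BB)
                 \<longrightarrow> l0 \<le> rv_inf (cond_rv (\<lambda>\<omega>. - E \<omega>) BB))
            \<longrightarrow> rv_sup (cond_rv (\<lambda>\<omega>. I \<omega> - E \<omega>) BB) \<ge> 0)
       \<and> (rv_sup (cond_rv (\<lambda>\<omega>. I \<omega> - E \<omega>) BB) \<ge> 0
            \<longrightarrow> (\<forall>l0 :: real. l0 \<le> rv_inf (cond_rv (\<lambda>\<omega>. - I \<omega>) BB)
                 \<longrightarrow> l0 \<le> rv_sup (cond_rv (\<lambda>\<omega>. - E \<omega>) BB)))"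
proof -
  have "bounded_rv I"
    unfolding assms(8) by (rule bounded_rv_gain) (rule assms(3))
  then have U: "bounded_rv (\<lambda>\<omega>. - I \<omega>)"
    by (rule bounded_rv_uminus)
  have "bounded_rv E"
    \<comment> \<open>\<open>E\<close> has the form of \<open>I\<close> with each \<open>X i\<close> replaced by the constant \<open>P (X i|B i)\<close>.\<close>
    unfolding assms(9)
    by (rule bounded_rv_gain[where X = "\<lambda>i \<omega>. P (cond_rv (X i) (B i))"]) (rule bounded_rv_const)
  then have V: "bounded_rv (\<lambda>\<omega>. - E \<omega>)"
    by (rule bounded_rv_uminus)
  have "BB \<noteq> {}"
    using assms(4)[of 0] unfolding assms(7) by auto
  note bounds = rv_inf_diff_le_rv_sup[OF U V this] rv_sup_diff_le[OF U V this]
  have "(\<lambda>\<omega>. - E \<omega> - (- I \<omega>)) = (\<lambda>\<omega>. I \<omega> - E \<omega>)"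
    by auto
  note bounds = bounds[unfolded this]
  show ?thesis
  proof (intro conjI impI allI)
    assume "\<forall>l0. l0 \<le> rv_inf (cond_rv (\<lambda>\<omega>. - I \<omega>) BB)
                 \<longrightarrow> l0 \<le> rv_inf (cond_rv (\<lambda>\<omega>. - E \<omega>) BB)"
    then have "rv_inf (cond_rv (\<lambda>\<omega>. - I \<omega>) BB) \<le> rv_inf (cond_rv (\<lambda>\<omega>. - E \<omega>) BB)"
      by blast
    then show "0 \<le> rv_sup (cond_rv (\<lambda>\<omega>. I \<omega> - E \<omega>) BB)"
      using bounds(1) by linarith
  next
    fix l0
    assume "0 \<le> rv_sup (cond_rv (\<lambda>\<omega>. I \<omega> - E \<omega>) BB)"
      and "l0 \<le> rv_inf (cond_rv (\<lambda>\<omega>. - I \<omega>) BB)"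
    then show "l0 \<le> rv_sup (cond_rv (\<lambda>\<omega>. - E \<omega>) BB)"
      using bounds(2) by linarith
  qed
qed

end
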